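(* Let $0<\lambda\le1$ and let $f\in\mathcal{U}(\lambda)$ be written as $$\frac{z}{f(z)}=1-a_2z+\lambda\,\omega_1(z),\qquad z\in\mathbb{D},$$ where $a_2=f''(0)/2$, $\omega_1\in B_0$ and $\omega_1'(0)=0$. If there exists a point $\zeta\in\mathbb{T}$ such that $|\omega_1(\zeta)|=1$, then $\omega_1$ is of the form $\omega_1(z)=e^{i\theta}z^2$ for some $\theta\in\mathbb{R}$.
   Context: $\mathbb{D}=\{z\in\mathbb{C}:|z|<1\}$, $\mathbb{T}=\{z\in\mathbb{C}:|z|=1\}$. $\mathcal{A}$ is the family of analytic functions $f$ in $\mathbb{D}$ with $f(0)=0=f'(0)-1$. For $0<\lambda\le1$, $\mathcal{U}(\lambda)$ is the set of $f\in\mathcal{A}$ with $\left|\left(\frac{z}{f(z)}\right)^2f'(z)-1\right|<\lambda$ for all $z\in\mathbb{D}$ (in particular $f$ does not vanish in $\mathbb{D}\setminus\{0\}$, and $z/f(z)$ is understood to be $1$ at $z=0$). $B$ is the set of analytic functions $\omega$ in $\mathbb{D}$ with $|\omega(z)|\le1$ for all $z\in\mathbb{D}$, and $B_0=\{\omega\in B:\omega(0)=0\}$. Every $f\in\mathcal{U}(\lambda)$ satisfies $\frac{z}{f(z)}=1-a_2z+\lambda z\int_0^z\omega(t)\,dt$ for some $\omega\in B$; thus $\omega_1(z)=z\int_0^z\omega(t)\,dt$ extends continuously to the closed disk $\overline{\mathbb{D}}$, and $\omega_1(\zeta)$ for $\zeta\in\mathbb{T}$ denotes the value of this extension. *)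

theory Defs
  imports "HOL-Complex_Analysis.Complex_Analysis"
begin

abbreviation unit_disk :: "complex set" where
  "unit_disk \<equiv> ball 0 1"

abbreviation unit_circle :: "complex set" where
  "unit_circle \<equiv> sphere 0 1"

definition class_A :: "(complex \<Rightarrow> complex) set" where
  "class_A = {f. f holomorphic_on unit_disk \<and> f 0 = 0 \<and> deriv f 0 = 1}"

text \<open>The quotient \<open>z / f z\<close>, with its removable singularity at the origin filled in
  (for normalised \<open>f\<close>, the limit there is \<open>1\<close>).\<close>

definition z_over :: "(complex \<Rightarrow> complex) \<Rightarrow> complex \<Rightarrow> complex" where
  "z_over f z = (if z = 0 then 1 else z / f z)"

text \<open>Nonvanishing is listed explicitly so that \<open>z / f z\<close> never relies on division by zero.\<close>

definition class_U :: "real \<Rightarrow> (complex \<Rightarrow> complex) set" where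
  "class_U lam = {f \<in> class_A.
     (\<forall>z \<in> unit_disk - {0}. f z \<noteq> 0) \<and>
     (\<forall>z \<in> unit_disk. norm ((z_over f z)\<^sup>2 * deriv f z - 1) < lam)}"

definition class_B :: "(complex \<Rightarrow> complex) set" where
  "class_B = {\<omega>. \<omega> holomorphic_on unit_disk \<and> (\<forall>z \<in> unit_disk. norm (\<omega> z) \<le> 1)}"

definition class_B0 :: "(complex \<Rightarrow> complex) set" where
  "class_B0 = {\<omega> \<in> class_B. \<omega> 0 = 0}"

text \<open>The value at a point of the unit circle of the continuous extension of \<open>g\<close> from the
  open disk to the closed disk. It depends only on the values of \<open>g\<close> inside the open disk.\<close>

definition boundary_value :: "(complex \<Rightarrow> complex) \<Rightarrow> complex \<Rightarrow> complex" where
  "boundary_value g \<zeta> = Lim (at \<zeta> within unit_disk) g"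

lemma boundary_value_eq_extension:
  assumes cont: "continuous_on (cball 0 1) G"
    and ext: "\<And>z. z \<in> unit_disk \<Longrightarrow> G z = g z"
    and \<zeta>: "\<zeta> \<in> unit_circle"
  shows "boundary_value g \<zeta> = G \<zeta>"
proof -
  have "(G \<longlongrightarrow> G \<zeta>) (at \<zeta> within cball 0 1)"
    using cont \<zeta> by (auto simp: continuous_on_def)
  then have "(G \<longlongrightarrow> G \<zeta>) (at \<zeta> within unit_disk)"
    by (rule tendsto_within_subset) auto
  then have lim: "(g \<longlongrightarrow> G \<zeta>) (at \<zeta> within unit_disk)"
    by (rule Lim_transform_eventually) (auto simp: eventually_at_filter ext)
  have "\<zeta> islimpt unit_disk"
    using \<zeta> by (simp add: islimpt_ball)
  then have "at \<zeta> within unit_disk \<noteq> bot"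
    by (simp add: trivial_limit_within)
  then show ?thesis
    unfolding boundary_value_def using lim by (rule tendsto_Lim)
qed

end

theory Submission
  imports Defs
begin

text \<open>With \<open>p z = z / f z\<close> one has \<open>p\<^sup>2 f' = p - z p'\<close>, so membership in \<open>class_U lam\<close>
  says \<open>\<bar>\<omega>\<^sub>1 - z \<omega>\<^sub>1'\<bar> < 1\<close>. Writing \<open>\<omega>\<^sub>1 z = z g z\<close> this becomes \<open>\<bar>z\<^sup>2 g'\<bar> < 1\<close>, and the
  maximum principle gives \<open>\<bar>g'\<bar> \<le> 1\<close>. Thus \<open>g\<close> is 1-Lipschitz with \<open>g 0 = 0\<close>; if its extension
  has modulus 1 at a boundary point \<open>\<zeta>\<close>, then \<open>\<bar>g\<bar>\<close> is the identity along the radius to \<open>\<zeta>\<close>, and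
  the equality case of the Schwarz lemma makes \<open>g\<close> a rotation.\<close>

text \<open>Differentiating \<open>p w * f w = w\<close> gives \<open>p f' + p' f = 1\<close>;
  multiplying by \<open>p\<close> and using \<open>p f = z\<close> once more eliminates
  \<open>f\<close>. Stating the relation as a product instead of a quotient covers the origin
  too.\<close>

lemma square_mult_deriv_quotient:
  assumes f: "f holomorphic_on S" and p: "p holomorphic_on S" and S: "open S" "z \<in> S"
    and eq: "\<And>w. w \<in> S \<Longrightarrow> p w * f w = w"
  shows "(p z)\<^sup>2 * deriv f z = p z - z * deriv p z"
proof -
  have "\<forall>\<^sub>F w in nhds z. p w * f w = w"
    using eventually_nhds_in_open[OF S] by eventually_elim (rule eq)
  then have "deriv (\<lambda>w. p w * f w) z = deriv (\<lambda>w. w) z"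
    by (rule deriv_cong_ev) simp
  then have "p z * deriv f z + deriv p z * f z = 1"
    using f p S by (simp add: holomorphic_on_imp_differentiable_at)
  then have "p z * (p z * deriv f z + deriv p z * f z) = p z"
    by simp
  then have "(p z)\<^sup>2 * deriv f z + deriv p z * (p z * f z) = p z"
    by (simp add: algebra_simps power2_eq_square)
  then show ?thesis
    unfolding eq[OF S(2)] by (simp add: algebra_simps)
qed

text \<open>On the circle of radius \<open>r\<close> the hypothesis bounds \<open>k\<close> by
  \<open>1 / r ^ n\<close>. The maximum principle carries this bound to the interior, and letting
  \<open>r\<close> tend to 1 yields the claim.\<close>

lemma norm_le_1_if_norm_power_mult_le_1:
  fixes k :: "complex \<Rightarrow> complex"
  assumes k: "k holomorphic_on ball 0 1"
    and bound: "\<And>z. norm z < 1 \<Longrightarrow> norm (z ^ n * k z) \<le> 1"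
    and w: "norm w < 1"
  shows "norm (k w) \<le> 1"
proof -
  have ineq: "r ^ n * norm (k w) \<le> 1" if r: "norm w < r" "r < 1" for r
  proof -
    have r0: "0 < r"
      using r(1) by (meson norm_ge_zero le_less_trans)
    have "norm (k w) \<le> 1 / r ^ n"
    proof (rule maximum_modulus_frontier[of k "cball 0 r"])
      show "k holomorphic_on interior (cball 0 r)"
        by (rule holomorphic_on_subset[OF k]) (use r in auto)
      show "continuous_on (closure (cball 0 r)) k"
        by (rule holomorphic_on_imp_continuous_on, rule holomorphic_on_subset[OF k])
          (use r in auto)
      fix z :: complex assume "z \<in> frontier (cball 0 r)"
      then have "norm z = r"
        using r0 by simp
      then show "norm (k z) \<le> 1 / r ^ n"
        using bound[of z] r r0 by (simp add: norm_mult norm_power field_simps)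
    qed (use r in auto)
    then show ?thesis
      using r0 by (simp add: field_simps)
  qed
  have "((\<lambda>r. r ^ n * norm (k w)) \<longlongrightarrow> 1 ^ n * norm (k w)) (at_left (1::real))"
    by (intro tendsto_intros)
  moreover have "\<forall>\<^sub>F r in at_left 1. r ^ n * norm (k w) \<le> 1"
    using eventually_at_left_real[OF w] by eventually_elim (simp add: ineq)
  ultimately have "1 ^ n * norm (k w) \<le> 1"
    by (rule tendsto_upperbound) simp
  then show ?thesis
    by simp
qed

text \<open>Uniform continuity and completeness of the target provide a continuous extension; the
  Lipschitz inequality then passes to limits with the same constant.\<close>

lemma lipschitz_on_extension_on_closure:
  fixes f :: "'a::metric_space \<Rightarrow> 'b::complete_space"
  assumes "C-lipschitz_on X f"
  obtains g where "C-lipschitz_on (closure X) g" "\<And>x. x \<in> X \<Longrightarrow> g x = f x"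
proof (rule uniformly_continuous_on_extension_on_closure
    [OF lipschitz_on_uniformly_continuous[OF assms]])
  fix g assume unif: "uniformly_continuous_on (closure X) g" and eq: "\<And>x. x \<in> X \<Longrightarrow> f x = g x"
  have "C-lipschitz_on X g"
    by (rule lipschitz_on_transform[OF assms]) (simp add: eq)
  then have "C-lipschitz_on (closure X) g"
    by (rule lipschitz_on_closure) (rule uniformly_continuous_imp_continuous[OF unif])
  then show thesis
    using that eq by simp
qed

text \<open>Since \<open>G\<close> is 1-Lipschitz and vanishes at 0, the modulus 1 at distance 1 is
  the largest possible, which forces equality at interior points of the radius, where the Schwarz
  lemma applies.\<close>

lemma lipschitz_boundary_extremal_imp_rotation:
  fixes g G :: "complex \<Rightarrow> complex"
  assumes g: "g holomorphic_on ball 0 1" "g 0 = 0"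
    and G: "1-lipschitz_on (cball 0 1) G" "\<And>z. norm z < 1 \<Longrightarrow> G z = g z"
    and \<zeta>: "norm \<zeta> = 1" "norm (G \<zeta>) = 1"
  obtains \<alpha> where "norm \<alpha> = 1" "\<And>z. norm z < 1 \<Longrightarrow> g z = \<alpha> * z"
proof -
  have le: "norm (g z) \<le> norm z" if "norm z < 1" for z
    using lipschitz_onD[OF G(1), of z 0] that G(2)[of z] G(2)[of 0] g(2) by (simp add: dist_norm)
  \<comment> \<open>Any point strictly between 0 and \<zeta> would do; the midpoint keeps the
    arithmetic simple.\<close>
  define w where "w = \<zeta> / 2"
  have w: "norm w = 1 / 2" "dist \<zeta> w = 1 / 2"
    using \<zeta>(1) by (simp_all add: w_def norm_divide dist_norm)
  have "dist (G \<zeta>) (G w) \<le> 1 / 2"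
    using lipschitz_onD[OF G(1), of \<zeta> w] w \<zeta>(1) by simp
  then have "1 / 2 \<le> norm (g w)"
    using norm_triangle_ineq2[of "G \<zeta>" "G w"] \<zeta>(2) G(2)[of w] w(1) by (simp add: dist_norm)
  then have "norm (g w) = norm w"
    using le[of w] w(1) by simp
  then have "\<exists>z. norm z < 1 \<and> z \<noteq> 0 \<and> norm (g z) = norm z"
    using w(1) by (intro exI[of _ w]) auto
  moreover have "norm (g z) < 1" if "norm z < 1" for z
    using le[OF that] that by simp
  ultimately have "\<exists>\<alpha>. (\<forall>z. norm z < 1 \<longrightarrow> g z = \<alpha> * z) \<and> norm \<alpha> = 1"
    by (intro Schwarz_Lemma(3)[OF g, of 0]) simp_all
  then show ?thesis
    using that by blast
qed

theorem theorem3: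
  fixes lam :: real and f \<omega>\<^sub>1 :: "complex \<Rightarrow> complex" and a\<^sub>2 :: complex
  assumes "0 < lam" and "lam \<le> 1"
    and "f \<in> class_U lam"
    and "a\<^sub>2 = (deriv ^^ 2) f 0 / 2"
    and "\<omega>\<^sub>1 \<in> class_B0" and "deriv \<omega>\<^sub>1 0 = 0"
    and "\<forall>z \<in> unit_disk. z_over f z = 1 - a\<^sub>2 * z + of_real lam * \<omega>\<^sub>1 z"
    and "\<exists>\<zeta> \<in> unit_circle. norm (boundary_value \<omega>\<^sub>1 \<zeta>) = 1"
  shows "\<exists>\<theta>::real. \<forall>z \<in> unit_disk. \<omega>\<^sub>1 z = exp (\<i> * of_real \<theta>) * z\<^sup>2"
proof -
  have hol: "\<omega>\<^sub>1 holomorphic_on unit_disk" and w0: "\<omega>\<^sub>1 0 = 0"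
    using assms(5) by (auto simp: class_B0_def class_B_def)
  have fhol: "f holomorphic_on unit_disk" and f0: "f 0 = 0"
    and fnz: "\<And>z. z \<in> unit_disk - {0} \<Longrightarrow> f z \<noteq> 0"
    and fU: "\<And>z. z \<in> unit_disk \<Longrightarrow> norm ((z_over f z)\<^sup>2 * deriv f z - 1) < lam"
    using assms(3) by (auto simp: class_U_def class_A_def)
  define p where "p = (\<lambda>z. 1 - a\<^sub>2 * z + of_real lam * \<omega>\<^sub>1 z)"
  \<comment> \<open>The value 0 at the origin is the derivative of \<open>\<omega>\<^sub>1\<close>
    there, so the singularity of the quotient is removed correctly.\<close>
  define g where "g = (\<lambda>z. if z = 0 then 0 else \<omega>\<^sub>1 z / z)"
  have p: "z_over f z = p z" if "z \<in> unit_disk" for z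
    using assms(7) that by (simp add: p_def)
  have phol: "p holomorphic_on unit_disk"
    unfolding p_def by (intro holomorphic_intros hol)
  have ghol: "g holomorphic_on unit_disk"
    by (rule pole_theorem_open_0[OF hol, where a = 0]) (auto simp: g_def w0 assms(6))
  have g0: "g 0 = 0" and wg: "\<omega>\<^sub>1 = (\<lambda>z. z * g z)"
    by (auto simp: g_def w0)
  have diffw: "\<omega>\<^sub>1 field_differentiable at z" and diffg: "g field_differentiable at z"
    if "z \<in> unit_disk" for z
    using that hol ghol by (auto intro: holomorphic_on_imp_differentiable_at)
  have "norm (z\<^sup>2 * deriv g z) \<le> 1" if z: "norm z < 1" for z
  proof -
    have zd: "z \<in> unit_disk"
      using z by simp
    have "p w * f w = w" if "w \<in> unit_disk" for w
      using p[OF that, symmetric] fnz[of w] f0 that by (cases "w = 0") (simp_all add: z_over_def)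
    then have "(p z)\<^sup>2 * deriv f z = p z - z * deriv p z"
      using square_mult_deriv_quotient[OF fhol phol _ zd] by simp
    moreover have "deriv p z = - a\<^sub>2 + lam * deriv \<omega>\<^sub>1 z"
      unfolding p_def using field_differentiable_derivI[OF diffw[OF zd]]
      by (intro DERIV_imp_deriv) (auto intro!: derivative_eq_intros)
    moreover have "deriv \<omega>\<^sub>1 z = g z + z * deriv g z"
      unfolding wg using field_differentiable_derivI[OF diffg[OF zd]]
      by (intro DERIV_imp_deriv) (auto intro!: derivative_eq_intros)
    ultimately have "(p z)\<^sup>2 * deriv f z - 1
        = p z - z * (- a\<^sub>2 + lam * (g z + z * deriv g z)) - 1"
      by simp
    \<comment> \<open>The operator sending \<open>p\<close> to \<open>p - z p'\<close> annihilates
      multiples of \<open>z\<close>, so \<open>a\<^sub>2\<close> drops out; the two terms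
      \<open>lam * z * g z\<close> cancel as well.\<close>
    also have "\<dots> = - (lam * (z\<^sup>2 * deriv g z))"
      by (simp add: p_def wg algebra_simps power2_eq_square)
    finally have "(p z)\<^sup>2 * deriv f z - 1 = - (lam * (z\<^sup>2 * deriv g z))" .
    then have "lam * norm (z\<^sup>2 * deriv g z) < lam"
      using fU[OF zd] p[OF zd] assms(1) by (simp add: norm_mult)
    then show ?thesis
      using assms(1) by simp
  qed
  then have bound: "norm (deriv g z) \<le> 1" if "norm z < 1" for z
    using norm_le_1_if_norm_power_mult_le_1[where n = 2 and k = "deriv g"] ghol that
    by (simp add: holomorphic_deriv)
  \<comment> \<open>Convexity of the disk turns the derivative bound into a Lipschitz bound.\<close>
  have "1-lipschitz_on unit_disk g"
  proof (rule lipschitz_onI)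
    fix x y :: complex assume xy: "x \<in> unit_disk" "y \<in> unit_disk"
    have "norm (g x - g y) \<le> 1 * norm (x - y)"
    proof (rule field_differentiable_bound[where S = unit_disk and f' = "deriv g"])
      fix z assume "z \<in> unit_disk"
      then show "(g has_field_derivative deriv g z) (at z within unit_disk)"
        by (rule has_field_derivative_at_within[OF field_differentiable_derivI[OF diffg]])
    qed (use xy bound in auto)
    then show "dist (g x) (g y) \<le> 1 * dist x y"
      by (simp add: dist_norm)
  qed simp
  then obtain G where "1-lipschitz_on (closure unit_disk) G"
    and Gg: "\<And>z. z \<in> unit_disk \<Longrightarrow> G z = g z"
    by (rule lipschitz_on_extension_on_closure) (rule that)
  then have G: "1-lipschitz_on (cball 0 1) G"
    by simp
  obtain \<zeta> where \<zeta>: "\<zeta> \<in> unit_circle" "norm (boundary_value \<omega>\<^sub>1 \<zeta>) = 1"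
    using assms(8) by blast
  \<comment> \<open>The function \<open>z * G z\<close> is continuous on the closed disk and agrees
    with \<open>\<omega>\<^sub>1\<close> inside, so it supplies the boundary values.\<close>
  have "boundary_value \<omega>\<^sub>1 \<zeta> = \<zeta> * G \<zeta>"
    using \<zeta>(1) Gg lipschitz_on_continuous_on[OF G]
    by (intro boundary_value_eq_extension)
      (auto intro!: continuous_on_mult continuous_on_id simp: wg)
  then have "norm (G \<zeta>) = 1"
    using \<zeta> by (simp add: norm_mult)
  then obtain \<alpha> where \<alpha>: "norm \<alpha> = 1" "\<And>z. norm z < 1 \<Longrightarrow> g z = \<alpha> * z"
    using lipschitz_boundary_extremal_imp_rotation[OF ghol g0 G, of \<zeta>] Gg \<zeta>(1) by auto
  obtain \<theta> where "\<alpha> = exp (\<i> * of_real \<theta>)"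
    using \<alpha>(1) by (metis complex_norm_eq_1_exp)
  then show ?thesis
    using \<alpha>(2) by (intro exI[of _ \<theta>]) (simp add: wg power2_eq_square)
qed

end
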